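(* Let $X$ and $Y$ be real Banach spaces and let $U\colon X\to Y$ be a locally isometric bijection. If $U^{-1}\colon Y\to X$ is continuous, then $U$ is an isometry, that is, $U$ is surjective and $\lVert U(x)-U(x')\rVert=\lVert x-x'\rVert$ for all $x,x'\in X$.
   Context: All Banach spaces are over $\mathbb{R}$, and $\lVert\cdot\rVert$ denotes the norm of both $X$ and $Y$. No linearity of maps is assumed. A map $f$ from a subset $V\subseteq X$ to $Y$ is called isometric if $\lVert f(x)-f(x')\rVert=\lVert x-x'\rVert$ for all $x,x'\in V$. A map $f\colon X\to Y$ is locally isometric if every $x\in X$ has an open neighborhood $V\subseteq X$ such that $f|_V$ is isometric (the image $f(V)$ is not required to be open in $Y$). An isometry is a surjective isometric map. *)

theory Defs
  imports "HOL-Analysis.Analysis"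
begin

definition isometric_on :: "'a::real_normed_vector set \<Rightarrow> ('a \<Rightarrow> 'b::real_normed_vector) \<Rightarrow> bool" where
  "isometric_on V f \<longleftrightarrow> (\<forall>x\<in>V. \<forall>x'\<in>V. norm (f x - f x') = norm (x - x'))"

text \<open>Note that the image of the neighborhood \<open>V\<close> is not required to be open in the codomain.\<close>

definition locally_isometric :: "('a::real_normed_vector \<Rightarrow> 'b::real_normed_vector) \<Rightarrow> bool" where
  "locally_isometric f \<longleftrightarrow> (\<forall>x. \<exists>V. open V \<and> x \<in> V \<and> isometric_on V f)"

text \<open>Linearity is not part of the notion.\<close>

definition isometry :: "('a::real_normed_vector \<Rightarrow> 'b::real_normed_vector) \<Rightarrow> bool" where
  "isometry f \<longleftrightarrow> surj f \<and> isometric_on UNIV f"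

end

theory Submission
  imports Defs
begin

text \<open>
  A local isometry does not increase distances, as one sees by subdividing the segment between two
  points. Continuity of \<open>U\<inverse>\<close> makes the images of the neighborhoods on which \<open>U\<close> is isometric open,
  so \<open>U\<inverse>\<close> is a local isometry too, and neither \<open>U\<close> nor \<open>U\<inverse>\<close> increases distances.
\<close>

lemma locally_isometric_nonexpansive:
  fixes f :: "'a::real_normed_vector \<Rightarrow> 'b::real_normed_vector"
  assumes "locally_isometric f"
  shows "norm (f x - f y) \<le> norm (x - y)"
proof -
  \<comment> \<open>The segment from \<open>x\<close> to \<open>y\<close> at constant speed, so that
    the lengths of adjacent pieces add up exactly.\<close>
  define c where "c t = x + t *\<^sub>R (y - x)" for t :: real
  have dist_c: "norm (c s - c t) = \<bar>t - s\<bar> * norm (x - y)" for s t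
  proof -
    have "c s - c t = (t - s) *\<^sub>R (x - y)"
      by (simp add: c_def algebra_simps)
    then show ?thesis
      by simp
  qed
  \<comment> \<open>Bisection replaces an explicit finite subdivision: a property of intervals that
    passes to unions of adjacent ones and holds for all short intervals around each point holds for
    \<open>[0,1]\<close>. The factor \<open>t - s\<close> makes the bound additive.\<close>
  have "norm (f (c 0) - f (c 1)) \<le> (1 - 0) * norm (x - y)"
  proof (rule Bolzano[where P = "\<lambda>s t. norm (f (c s) - f (c t)) \<le> (t - s) * norm (x - y)"])
    fix r s t
    assume "norm (f (c r) - f (c s)) \<le> (s - r) * norm (x - y)"
      and "norm (f (c s) - f (c t)) \<le> (t - s) * norm (x - y)"
    moreover have "norm (f (c r) - f (c t)) \<le> norm (f (c r) - f (c s)) + norm (f (c s) - f (c t))"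
      using norm_triangle_ineq[of "f (c r) - f (c s)" "f (c s) - f (c t)"] by simp
    ultimately show "norm (f (c r) - f (c t)) \<le> (t - r) * norm (x - y)"
      by (simp add: algebra_simps)
  next
    fix t :: real
    obtain V where V: "open V" "c t \<in> V" "isometric_on V f"
      using assms unfolding locally_isometric_def by blast
    have "open (c -` V)"
      using V(1) unfolding c_def by (intro open_vimage continuous_intros)
    then obtain d where d: "d > 0" "\<And>s. dist s t < d \<Longrightarrow> c s \<in> V"
      using V(2) unfolding open_dist by force
    have "norm (f (c a) - f (c b)) \<le> (b - a) * norm (x - y)"
      if "a \<le> t" "t \<le> b" "b - a < d" for a b
    proof -
      \<comment> \<open>As \<open>t\<close> lies between \<open>a\<close> and \<open>b\<close>, both
        are within \<open>b - a < d\<close> of \<open>t\<close>.\<close>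
      have "c a \<in> V" "c b \<in> V"
        using that by (auto intro!: d(2) simp: dist_real_def)
      then show ?thesis
        using V(3) that dist_c[of a b] unfolding isometric_on_def by simp
    qed
    then show "\<exists>d>0. \<forall>a b. a \<le> t \<and> t \<le> b \<and> b - a < d \<longrightarrow>
        norm (f (c a) - f (c b)) \<le> (b - a) * norm (x - y)"
      using d(1) by blast
  qed simp
  then show ?thesis
    by (simp add: c_def)
qed

lemma locally_isometric_inv:
  assumes "locally_isometric f" "bij f" "continuous_on UNIV (inv f)"
  shows "locally_isometric (inv f)"
  unfolding locally_isometric_def
proof
  fix y
  obtain V where V: "open V" "inv f y \<in> V" "isometric_on V f"
    using assms(1) unfolding locally_isometric_def by blast
  \<comment> \<open>By bijectivity this preimage is the image of \<open>V\<close> under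
    \<open>f\<close>; writing it as a preimage under \<open>inv f\<close> lets continuity give
    openness directly.\<close>
  have "isometric_on (inv f -` V) (inv f)"
    using V(3) assms(2) unfolding isometric_on_def
    by (metis bij_is_surj surj_f_inv_f vimageE)
  moreover have "open (inv f -` V)"
    using V(1) assms(3) by (simp add: open_vimage)
  ultimately show "\<exists>W. open W \<and> y \<in> W \<and> isometric_on W (inv f)"
    using V(2) by blast
qed

theorem corollary1p3:
  fixes U :: "'x::banach \<Rightarrow> 'y::banach"
  assumes "locally_isometric U"
    and "bij U"
    and "continuous_on UNIV (inv U)"
  shows "isometry U"
proof -
  have "norm (U x - U x') = norm (x - x')" for x x'
  proof (rule antisym)
    show "norm (U x - U x') \<le> norm (x - x')"
      using assms(1) by (rule locally_isometric_nonexpansive)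
    show "norm (x - x') \<le> norm (U x - U x')"
      \<comment> \<open>Injectivity turns \<open>inv U (U x)\<close> back into
        \<open>x\<close>.\<close>
      using locally_isometric_nonexpansive[OF locally_isometric_inv[OF assms], of "U x" "U x'"] assms(2)
      by (simp add: bij_is_inj)
  qed
  then show ?thesis
    using assms(2) by (simp add: isometry_def isometric_on_def bij_is_surj)
qed

end
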